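(* Let $B\in M(n;\mathbb{R})$ and $d\in\mathbb{R}^n$, and consider the inhomogeneous linear system $$\ddot c(t)=Bc(t)+d. \qquad (\mathrm{E})$$ For a solution $c:\mathbb{R}\to\mathbb{R}^n$ of (E) define $c_s(t):=\frac14\{c(t-s)+2c(t)+c(t+s)\}$ for $s,t\in\mathbb{R}$. Then there are vectors $b(s)\in\mathbb{R}^n$, $s\in\mathbb{R}$, such that for all $s,t\in\mathbb{R}$ $$c_s(t)=A(s)c(t)+b(s),\qquad\text{with } A(s)=\tfrac12\left\{\mathbb{1}+\mathrm{co}_B(s)\right\}.$$ More precisely, in the following three cases the solutions and the vectors $b(s)$ are given as follows. (a) If there is a vector $d_*\in\mathbb{R}^n$ with $d=Bd_*$, then for $v,w\in\mathbb{R}^n$ the unique solution of (E) with initial values $c(0)=v$, $\dot c(0)=w$ is $$c(t)=\mathrm{co}_B(t)(v+d_* )+\mathrm{si}_B(t)(w)-d_*,$$ and $$b(s)=\tfrac12\left\{\mathrm{co}_B(s)-\mathbb{1}\right\}(d_* ).$$ (b) Let $B=N_n$ be the nilpotent Jordan block, i.e. $N_n(e_1)=0$ and $N_n(e_j)=e_{j-1}$ for $2\le j\le n$, where $e_1,\ldots,e_n$ is the standard basis of $\mathbb{R}^n$. Then the unique solution $c_*$ of $\ddot c_*(t)=N_nc_*(t)+e_n$, $c_*(0)=\dot c_*(0)=0$, is $$c_*(t)=\left(\frac{t^{2n}}{(2n)!},\ldots,\frac{t^4}{4!},\frac{t^2}{2!}\right).$$ The vector $d=(d_1,\ldots,d_n)$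 can be written as $d=Bd_*+d_ne_n$ with $d_*=(0,d_1,\ldots,d_{n-1})$. The unique solution of (E) with initial values $c(0)=v$, $\dot c(0)=w$ is $$c(t)=\mathrm{co}_B(t)(v+d_* )+\mathrm{si}_B(t)(w)-d_*+d_nc_*(t),$$ and $$b(s)=\tfrac12\left\{\mathrm{co}_B(s)-\mathbb{1}\right\}(d_* )+\tfrac12\,d_n\,c_*(s).$$ (c) If $B=0$, then the unique solution of (E) with initial values $c(0)=v$, $\dot c(0)=w$ and its one-parameter family $c_s$ are $$c(t)=\frac{t^2}{2}d+wt+v,\qquad c_s(t)=c(t)+\tfrac14s^2d,$$ and $b(s)=\frac14s^2d$.
   Context: $M(n;\mathbb{R})$ is the space of real $n\times n$ matrices and $\mathbb{1}$ the identity matrix. For $B\in M(n;\mathbb{R})$ and $t\in\mathbb{R}$, $\mathrm{co}_B(t):=\sum_{k=0}^\infty\frac{t^{2k}}{(2k)!}B^k$ and $\mathrm{si}_B(t):=\sum_{k=0}^\infty\frac{t^{2k+1}}{(2k+1)!}B^k$. *)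

theory Defs
  imports "HOL-Analysis.Analysis"
begin

text \<open>
  The power operator is not available for the matrix product \<open>**\<close>, since \<open>*\<close> on
  type \<open>vec\<close> is componentwise.
\<close>

primrec mat_power :: "real^'n^'n \<Rightarrow> nat \<Rightarrow> real^'n^'n" where
  "mat_power B 0 = mat 1"
| "mat_power B (Suc k) = B ** mat_power B k"

definition co :: "real^'n^'n \<Rightarrow> real \<Rightarrow> real^'n^'n" where
  "co B t = (\<Sum>k. (t ^ (2 * k) / fact (2 * k)) *\<^sub>R mat_power B k)"

definition si :: "real^'n^'n \<Rightarrow> real \<Rightarrow> real^'n^'n" where
  "si B t = (\<Sum>k. (t ^ (2 * k + 1) / fact (2 * k + 1)) *\<^sub>R mat_power B k)"

definition velocity :: "(real \<Rightarrow> real^'n) \<Rightarrow> real \<Rightarrow> real^'n" where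
  "velocity c t = vector_derivative c (at t)"

definition is_solution :: "real^'n^'n \<Rightarrow> real^'n \<Rightarrow> (real \<Rightarrow> real^'n) \<Rightarrow> bool" where
  "is_solution B d c \<longleftrightarrow>
     (\<forall>t. c differentiable (at t)) \<and>
     (\<forall>t. (velocity c has_vector_derivative (B *v c t + d)) (at t))"

definition is_solution_ivp ::
  "real^'n^'n \<Rightarrow> real^'n \<Rightarrow> real^'n \<Rightarrow> real^'n \<Rightarrow> (real \<Rightarrow> real^'n) \<Rightarrow> bool" where
  "is_solution_ivp B d v w c \<longleftrightarrow> is_solution B d c \<and> c 0 = v \<and> velocity c 0 = w"

definition avg_curve :: "(real \<Rightarrow> real^'n) \<Rightarrow> real \<Rightarrow> real \<Rightarrow> real^'n" where
  "avg_curve c s t = (1/4) *\<^sub>R (c (t - s) + 2 *\<^sub>R c t + c (t + s))"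

definition avg_mat :: "real^'n^'n \<Rightarrow> real \<Rightarrow> real^'n^'n" where
  "avg_mat B s = (1/2) *\<^sub>R (mat 1 + co B s)"

text \<open>
  The index type \<open>'n\<close> carries no order.  The coordinates of \<open>real^'n\<close> are numbered
  \<open>1, \<dots>, n\<close> (where \<open>n = CARD('n)\<close>) by a bijection \<open>ix\<close> from \<open>{1..n}\<close> onto \<open>'n\<close>:
  \<open>std_basis ix j\<close> is the basis vector \<open>e\<close> with index \<open>j\<close>, and \<open>tuple ix x\<close> is the
  vector \<open>(x 1, \<dots>, x n)\<close>.
\<close>

definition std_basis :: "(nat \<Rightarrow> 'n) \<Rightarrow> nat \<Rightarrow> real^'n" where
  "std_basis ix j = axis (ix j) 1"

definition tuple :: "(nat \<Rightarrow> 'n) \<Rightarrow> (nat \<Rightarrow> real) \<Rightarrow> real^'n" where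
  "tuple ix x = (\<Sum>j = 1..CARD('n). x j *\<^sub>R std_basis ix j)"

definition is_nilpotent_jordan_block :: "(nat \<Rightarrow> 'n) \<Rightarrow> real^'n^'n \<Rightarrow> bool" where
  "is_nilpotent_jordan_block ix N \<longleftrightarrow>
     N *v std_basis ix 1 = 0 \<and>
     (\<forall>j \<in> {2..CARD('n)}. N *v std_basis ix j = std_basis ix (j - 1))"

text \<open>The curve \<open>(t^(2n) / (2n)!, \<dots>, t^4 / 4!, t^2 / 2!)\<close>.\<close>

definition c_star :: "(nat \<Rightarrow> 'n) \<Rightarrow> real \<Rightarrow> real^'n" where
  "c_star ix t =
     tuple ix (\<lambda>j. t ^ (2 * (CARD('n) + 1 - j)) / fact (2 * (CARD('n) + 1 - j)))"

text \<open>The vector \<open>(0, d\<^sub>1, \<dots>, d\<^sub>n\<^sub>-\<^sub>1)\<close>.\<close>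

definition shift_vec :: "(nat \<Rightarrow> 'n) \<Rightarrow> real^'n \<Rightarrow> real^'n" where
  "shift_vec ix d = tuple ix (\<lambda>j. if j = 1 then 0 else d $ ix (j - 1))"

end

theory Submission
  imports Defs
begin

text \<open>
  All three cases are one formula.  Besides \<open>co\<close> and \<open>si\<close> consider the next member of the same
  family, \<open>K = coseries 2 B\<close>, that is \<open>K t = (\<Sum>k. t^(2k+2) / (2k+2)! B^k)\<close>.  Differentiation lowers the exponent of \<open>t\<close>, so
  \<open>K' = si\<close>, \<open>si' = co\<close>, and splitting off the term \<open>k = 0\<close> gives \<open>co = 1 + B K\<close>, hence
  \<open>co' = B si\<close>.  It follows that \<open>co t v + si t w + K t d\<close> solves \<open>c'' = B c + d\<close> with initial values
  \<open>v\<close>, \<open>w\<close>.  It is the only solution: for any solution \<open>c\<close> and any fixed \<open>T\<close> the quantity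
  \<open>co (T - t) (c t) + si (T - t) (c' t) + K (T - t) d\<close> is independent of \<open>t\<close>, and its values at
  \<open>t = T\<close> and \<open>t = 0\<close> are \<open>c T\<close> and the formula (\<open>is_solution_ivp_iff\<close>).

  The averages are an application of uniqueness.  For fixed \<open>t\<close> the curve
  \<open>s \<mapsto> c (t - s) + c (t + s)\<close> solves the equation with constant term \<open>2 d\<close> and initial values
  \<open>2 c t\<close> and \<open>0\<close>, so it equals \<open>2 co s (c t) + 2 K s d\<close>.  Therefore \<open>b s = K s d / 2\<close>
  (\<open>avg_curve_solution\<close>).

  The three cases only evaluate \<open>K s d\<close>.  If \<open>d = B d'\<close> then
  \<open>K s d = (co s - 1) d'\<close>.  For the nilpotent block \<open>d\<close> is such a vector plus a multiple of the last basis
  vector \<open>e n\<close>, and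
  \<open>K s (e n) = c_star s\<close> because \<open>B^k\<close> maps \<open>e n\<close> to \<open>e (n - k)\<close> and to \<open>0\<close> from \<open>k = n\<close> on.  For
  \<open>B = 0\<close> only the term \<open>k = 0\<close> survives.
\<close>

section \<open>Matrix power series\<close>

text \<open>
  The derivatives are dominated by one summable sequence on all of \<open>S\<close>, so their partial sums
  converge uniformly and the limit may be differentiated term by term.
\<close>

lemma has_vector_derivative_suminf:
  fixes f :: "nat \<Rightarrow> real \<Rightarrow> 'b::banach"
  assumes "convex S" "open S" "t \<in> S"
    and deriv: "\<And>n x. x \<in> S \<Longrightarrow> (f n has_vector_derivative f' n x) (at x)"
    and bound: "\<And>n x. x \<in> S \<Longrightarrow> norm (f' n x) \<le> M n"
    and M: "summable M"
    and summable: "summable (\<lambda>n. f n t)"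
  shows "((\<lambda>x. \<Sum>n. f n x) has_vector_derivative (\<Sum>n. f' n t)) (at t)"
proof -
  define g' where "g' = (\<lambda>x. \<Sum>n. f' n x)"
  have lim: "uniform_limit S (\<lambda>n x. \<Sum>i<n. f' i x) g' sequentially"
    unfolding g'_def by (rule Weierstrass_m_test[OF bound M])
  have "\<exists>g. \<forall>x\<in>S. (\<lambda>n. f n x) sums (g x) \<and>
      (g has_derivative (\<lambda>h. h *\<^sub>R g' x)) (at x within S)"
  proof (rule has_derivative_series[where f' = "\<lambda>n x h. h *\<^sub>R f' n x" and x = t])
    show "(f n has_derivative (\<lambda>h. h *\<^sub>R f' n x)) (at x within S)" if "x \<in> S" for n x
      using deriv[OF that] has_derivative_at_withinI unfolding has_vector_derivative_def by blast
    show "\<forall>\<^sub>F n in sequentially. \<forall>x\<in>S. \<forall>h.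
        norm ((\<Sum>i<n. h *\<^sub>R f' i x) - h *\<^sub>R g' x) \<le> e * norm h" if "e > 0" for e
      using uniform_limitD[OF lim that]
    proof eventually_elim
      case (elim n)
      have "norm ((\<Sum>i<n. h *\<^sub>R f' i x) - h *\<^sub>R g' x) \<le> e * norm h" if "x \<in> S" for x h
      proof -
        have "norm ((\<Sum>i<n. h *\<^sub>R f' i x) - h *\<^sub>R g' x) = \<bar>h\<bar> * norm ((\<Sum>i<n. f' i x) - g' x)"
          by (metis norm_scaleR scaleR_right_diff_distrib scaleR_right.sum)
        also have "\<dots> \<le> \<bar>h\<bar> * e"
          using elim that by (intro mult_left_mono) (auto simp: dist_norm intro: less_imp_le)
        finally show ?thesis by (simp add: mult.commute)
      qed
      then show ?case by blast
    qed
    show "(\<lambda>n. f n t) sums (\<Sum>n. f n t)" using summable by (rule summable_sums)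
  qed (use assms in auto)
  then obtain g where g: "\<And>x. x \<in> S \<Longrightarrow> (\<lambda>n. f n x) sums g x"
    "\<And>x. x \<in> S \<Longrightarrow> (g has_derivative (\<lambda>h. h *\<^sub>R g' x)) (at x within S)" by blast
  have "(g has_derivative (\<lambda>h. h *\<^sub>R g' t)) (at t)"
    using g(2)[OF \<open>t \<in> S\<close>] at_within_open[OF \<open>t \<in> S\<close> \<open>open S\<close>] by simp
  then have "((\<lambda>x. \<Sum>n. f n x) has_derivative (\<lambda>h. h *\<^sub>R g' t)) (at t)"
    by (rule has_derivative_transform_within_open[OF _ \<open>open S\<close> \<open>t \<in> S\<close>])
      (use g(1) in \<open>simp add: sums_iff\<close>)
  then show ?thesis unfolding has_vector_derivative_def g'_def .
qed

lemma bounded_bilinear_matrix_matrix_mult: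
  "bounded_bilinear ((**) :: real^'m^'k \<Rightarrow> real^'n^'m \<Rightarrow> real^'n^'k)"
  unfolding bilinear_conv_bounded_bilinear[symmetric] bilinear_def
  by (auto intro!: linearI simp: matrix_matrix_mult_def vec_eq_iff algebra_simps sum.distrib
      sum_distrib_left)

lemma bounded_bilinear_matrix_vector_mult:
  "bounded_bilinear ((*v) :: real^'m^'k \<Rightarrow> real^'m \<Rightarrow> real^'k)"
  unfolding bilinear_conv_bounded_bilinear[symmetric] bilinear_def
  by (auto intro!: linearI simp: matrix_vector_mult_add_rdistrib matrix_vector_right_distrib
      scaleR_matrix_vector_assoc matrix_vector_mult_scaleR)

lemmas has_vector_derivative_matrix_vector_mult =
  bounded_bilinear.has_vector_derivative[OF bounded_bilinear_matrix_vector_mult]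

lemma mat_power_commute: "mat_power B k ** B = B ** mat_power B k"
  by (induction k) (simp_all add: matrix_mul_assoc[symmetric])

lemma norm_mat_power_le:
  fixes B :: "real^'n^'n"
  obtains q where "q \<ge> 0" "\<And>k. norm (mat_power B k) \<le> norm (mat 1 :: real^'n^'n) * q ^ k"
proof -
  obtain K where K: "K > 0" "\<And>(X :: real^'n^'n) (Y :: real^'n^'n). norm (X ** Y) \<le> norm X * norm Y * K"
    using bounded_bilinear.pos_bounded[OF bounded_bilinear_matrix_matrix_mult] by blast
  have "norm (mat_power B k) \<le> norm (mat 1 :: real^'n^'n) * (norm B * K) ^ k" for k
  proof (induction k)
    case (Suc k)
    have "norm (mat_power B (Suc k)) \<le> (norm B * K) * norm (mat_power B k)"
      using K(2)[of B "mat_power B k"] by (simp add: mult_ac)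
    also have "\<dots> \<le> (norm B * K) * (norm (mat 1 :: real^'n^'n) * (norm B * K) ^ k)"
      using K(1) Suc by (intro mult_left_mono) auto
    finally show ?case by (simp add: mult_ac)
  qed simp
  with that[of "norm B * K"] K(1) show thesis by simp
qed

text \<open>
  The common family of \<open>co\<close> (\<open>m = 0\<close>), \<open>si\<close> (\<open>m = 1\<close>) and the propagator of the inhomogeneity
  (\<open>m = 2\<close>); with the shift \<open>m\<close> as a parameter one differentiation rule covers all of them.
\<close>

definition coseries :: "nat \<Rightarrow> real^'n^'n \<Rightarrow> real \<Rightarrow> real^'n^'n" where
  "coseries m B t = (\<Sum>k. (t ^ (2 * k + m) / fact (2 * k + m)) *\<^sub>R mat_power B k)"

lemma co_eq_coseries: "co B = coseries 0 B"
  by (simp add: fun_eq_iff co_def coseries_def)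

lemma si_eq_coseries: "si B = coseries 1 B"
  by (simp add: fun_eq_iff si_def coseries_def)

text \<open>
  Since \<open>k! \<le> (2k+m)!\<close>, an exponential series in \<open>R^2 q\<close> dominates \<open>coseries\<close> on \<open>[-R, R]\<close>, where \<open>q\<close>
  is the growth rate of the powers of \<open>B\<close>.
\<close>

lemma coseries_majorant:
  fixes B :: "real^'n^'n"
  obtains M where "summable M"
    "\<And>k t. \<bar>t\<bar> \<le> R \<Longrightarrow> norm ((t ^ (2 * k + m) / fact (2 * k + m)) *\<^sub>R mat_power B k) \<le> M k"
proof -
  obtain q where q: "q \<ge> 0" "\<And>k. norm (mat_power B k) \<le> norm (mat 1 :: real^'n^'n) * q ^ k"
    by (rule norm_mat_power_le[of B]) blast
  define M where "M = (\<lambda>k. (R ^ m * norm (mat 1 :: real^'n^'n)) * (inverse (fact k) * (R\<^sup>2 * q) ^ k))"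
  have "summable M"
    unfolding M_def by (intro summable_mult summable_exp)
  moreover have "norm ((t ^ (2 * k + m) / fact (2 * k + m)) *\<^sub>R mat_power B k) \<le> M k"
    if "\<bar>t\<bar> \<le> R" for k t
  proof -
    have "(fact k :: real) \<le> fact (2 * k + m)"
      by (rule fact_mono) simp
    then have "\<bar>t\<bar> ^ (2 * k + m) / fact (2 * k + m) \<le> R ^ (2 * k + m) / fact k"
      using that by (intro frac_le power_mono) auto
    moreover have "0 \<le> R" using that by linarith
    ultimately have "(\<bar>t\<bar> ^ (2 * k + m) / fact (2 * k + m)) * norm (mat_power B k)
        \<le> (R ^ (2 * k + m) / fact k) * (norm (mat 1 :: real^'n^'n) * q ^ k)"
      by (intro mult_mono q(2)) simp_all
    also have "R ^ (2 * k + m) = R ^ m * R\<^sup>2 ^ k"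
      by (simp add: power_add power_mult)
    also have "R ^ m * R\<^sup>2 ^ k / fact k * (norm (mat 1 :: real^'n^'n) * q ^ k) = M k"
      by (simp add: M_def power_mult_distrib divide_inverse)
    finally show ?thesis by (simp add: power_abs)
  qed
  ultimately show thesis by (rule that)
qed

lemma coseries_sums:
  "(\<lambda>k. (t ^ (2 * k + m) / fact (2 * k + m)) *\<^sub>R mat_power B k) sums coseries m B t"
proof -
  obtain M where "summable M" and
    "\<And>k x. \<bar>x\<bar> \<le> \<bar>t\<bar> \<Longrightarrow> norm ((x ^ (2 * k + m) / fact (2 * k + m)) *\<^sub>R mat_power B k) \<le> M k"
    by (rule coseries_majorant[where R = "\<bar>t\<bar>" and m = m and B = B]) blast
  then have "summable (\<lambda>k. (t ^ (2 * k + m) / fact (2 * k + m)) *\<^sub>R mat_power B k)"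
    by (rule summable_comparison_test'[where N = 0]) simp
  then show ?thesis unfolding coseries_def by (rule summable_sums)
qed

lemma coseries_vector_sums:
  "(\<lambda>k. (t ^ (2 * k + m) / fact (2 * k + m)) *\<^sub>R (mat_power B k *v x)) sums (coseries m B t *v x)"
  using bounded_linear.sums[OF bounded_bilinear.bounded_linear_left
      [OF bounded_bilinear_matrix_vector_mult] coseries_sums]
  by (simp add: scaleR_matrix_vector_assoc)

lemma coseries_Suc_has_vector_derivative:
  "(coseries (Suc m) B has_vector_derivative coseries m B t) (at t)"
proof -
  define f where "f = (\<lambda>m k (t::real). (t ^ (2 * k + m) / fact (2 * k + m)) *\<^sub>R mat_power B k)"
  have eq: "coseries m B = (\<lambda>t. \<Sum>k. f m k t)" for m
    by (simp add: f_def coseries_def fun_eq_iff)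
  obtain M where M: "summable M" "\<And>k x. \<bar>x\<bar> \<le> \<bar>t\<bar> + 1 \<Longrightarrow> norm (f m k x) \<le> M k"
    unfolding f_def by (rule coseries_majorant[where R = "\<bar>t\<bar> + 1" and m = m and B = B]) blast
  have "((\<lambda>x. \<Sum>k. f (Suc m) k x) has_vector_derivative (\<Sum>k. f m k t)) (at t)"
  proof (rule has_vector_derivative_suminf[where S = "ball 0 (\<bar>t\<bar> + 1)" and M = M])
    show "(f (Suc m) k has_vector_derivative f m k x) (at x)" for k x
    proof -
      have "((\<lambda>x. x ^ Suc (2 * k + m) / fact (Suc (2 * k + m))) has_real_derivative
          x ^ (2 * k + m) / fact (2 * k + m)) (at x)"
        using DERIV_cdivide[OF DERIV_pow[of "Suc (2 * k + m)" x], of "fact (Suc (2 * k + m))"]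
        by (simp del: of_nat_Suc)
      then have "((\<lambda>x. (x ^ Suc (2 * k + m) / fact (Suc (2 * k + m))) *\<^sub>R mat_power B k)
          has_vector_derivative (x ^ (2 * k + m) / fact (2 * k + m)) *\<^sub>R mat_power B k
          + (x ^ Suc (2 * k + m) / fact (Suc (2 * k + m))) *\<^sub>R 0) (at x)"
        by (intro derivative_eq_intros) auto
      then show ?thesis by (simp add: f_def)
    qed
    show "norm (f m k x) \<le> M k" if "x \<in> ball 0 (\<bar>t\<bar> + 1)" for k x
      using that by (intro M(2)) simp
    show "summable (\<lambda>k. f (Suc m) k t)"
      unfolding f_def using coseries_sums by (rule sums_summable)
  qed (use M(1) in auto)
  then show ?thesis by (simp only: eq)
qed

lemma coseries_matrix_commute: "coseries m B t ** B = B ** coseries m B t"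
proof (rule sums_unique2)
  show "(\<lambda>k. (t ^ (2 * k + m) / fact (2 * k + m)) *\<^sub>R (mat_power B k ** B)) sums
      (coseries m B t ** B)"
    using bounded_linear.sums[OF bounded_bilinear.bounded_linear_left
        [OF bounded_bilinear_matrix_matrix_mult] coseries_sums]
    by (simp add: bounded_bilinear.scaleR_left[OF bounded_bilinear_matrix_matrix_mult])
  show "(\<lambda>k. (t ^ (2 * k + m) / fact (2 * k + m)) *\<^sub>R (mat_power B k ** B)) sums
      (B ** coseries m B t)"
    using bounded_linear.sums[OF bounded_bilinear.bounded_linear_right
        [OF bounded_bilinear_matrix_matrix_mult] coseries_sums]
    by (simp add: bounded_bilinear.scaleR_right[OF bounded_bilinear_matrix_matrix_mult]
        mat_power_commute)
qed

text \<open>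
  This closes the system of derivatives: it expresses the derivative of \<open>co\<close>, which
  the rule for \<open>coseries (Suc m)\<close> does not reach, through that of \<open>coseries 2\<close>.
\<close>

lemma co_eq_coseries_2: "co B t = mat 1 + B ** coseries 2 B t"
proof -
  have "(\<lambda>k. (t ^ (2 * Suc k) / fact (2 * Suc k)) *\<^sub>R mat_power B (Suc k)) sums
      (B ** coseries 2 B t)"
    using bounded_linear.sums[OF bounded_bilinear.bounded_linear_right
        [OF bounded_bilinear_matrix_matrix_mult] coseries_sums[of t 2 B]]
    by (simp add: bounded_bilinear.scaleR_right[OF bounded_bilinear_matrix_matrix_mult])
  then have "(\<lambda>k. (t ^ (2 * k) / fact (2 * k)) *\<^sub>R mat_power B k) sums
      (B ** coseries 2 B t + (t ^ (2 * 0) / fact (2 * 0)) *\<^sub>R mat_power B 0)"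
    by (rule sums_Suc)
  then show ?thesis
    by (simp add: co_def sums_iff add.commute)
qed

lemma coseries_2_has_vector_derivative:
  "(coseries 2 B has_vector_derivative si B t) (at t)"
  using coseries_Suc_has_vector_derivative[of 1 B t] by (simp add: si_eq_coseries numeral_2_eq_2)

lemma si_has_vector_derivative: "(si B has_vector_derivative co B t) (at t)"
  using coseries_Suc_has_vector_derivative[of 0 B t] by (simp add: si_eq_coseries co_eq_coseries)

lemma co_has_vector_derivative: "(co B has_vector_derivative B ** si B t) (at t)"
proof -
  have "((\<lambda>t. mat 1 + B ** coseries 2 B t) has_vector_derivative 0 + B ** si B t) (at t)"
    by (intro has_vector_derivative_add has_vector_derivative_const
        bounded_linear.has_vector_derivative[OF bounded_bilinear.bounded_linear_right
          [OF bounded_bilinear_matrix_matrix_mult]] coseries_2_has_vector_derivative)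
  then show ?thesis by (simp add: co_eq_coseries_2[abs_def])
qed

lemma coseries_at_0: "coseries (Suc m) B 0 = 0"
  by (simp add: coseries_def)

lemma co_0: "co B 0 = mat 1"
  using co_eq_coseries_2[of B 0] coseries_at_0[of 1 B] by (simp add: numeral_2_eq_2)

lemma si_0: "si B 0 = 0"
  using coseries_at_0[of 0 B] by (simp add: si_eq_coseries)

lemma coseries_2_mult_vector: "coseries 2 B s *v (B *v x) = (co B s - mat 1) *v x"
  by (simp add: co_eq_coseries_2 matrix_vector_mul_assoc coseries_matrix_commute)

section \<open>The initial value problem\<close>

lemma velocity_eqI:
  assumes "\<And>t. (c has_vector_derivative c' t) (at t)"
  shows "velocity c = c'"
  using vector_derivative_at[OF assms] by (simp add: velocity_def fun_eq_iff)

lemma is_solution_altdef: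
  "is_solution B d c \<longleftrightarrow> (\<exists>c'. (\<forall>t. (c has_vector_derivative c' t) (at t)) \<and>
     (\<forall>t. (c' has_vector_derivative B *v c t + d) (at t)))"
proof
  assume "is_solution B d c"
  then show "\<exists>c'. (\<forall>t. (c has_vector_derivative c' t) (at t)) \<and>
      (\<forall>t. (c' has_vector_derivative B *v c t + d) (at t))"
    by (intro exI[of _ "velocity c"])
      (auto simp: is_solution_def velocity_def vector_derivative_works)
next
  assume "\<exists>c'. (\<forall>t. (c has_vector_derivative c' t) (at t)) \<and>
      (\<forall>t. (c' has_vector_derivative B *v c t + d) (at t))"
  then obtain c' where c': "\<And>t. (c has_vector_derivative c' t) (at t)"
    "\<And>t. (c' has_vector_derivative B *v c t + d) (at t)" by blast
  have "velocity c = c'"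
    using c'(1) by (rule velocity_eqI)
  with c' show "is_solution B d c"
    by (auto simp: is_solution_def intro: differentiableI_vector)
qed

lemma is_solution_ivp_altdef:
  "is_solution_ivp B d v w c \<longleftrightarrow> (\<exists>c'. (\<forall>t. (c has_vector_derivative c' t) (at t)) \<and>
     (\<forall>t. (c' has_vector_derivative B *v c t + d) (at t)) \<and> c 0 = v \<and> c' 0 = w)"
  unfolding is_solution_ivp_def is_solution_altdef
  using velocity_eqI by blast

lemma ivp_solution:
  "is_solution_ivp B d v w (\<lambda>t. co B t *v v + si B t *v w + coseries 2 B t *v d)"
proof -
  have const: "((\<lambda>t. X t *v x) has_vector_derivative X' *v x) (at t)"
    if "(X has_vector_derivative X') (at t)" for X :: "real \<Rightarrow> real^'a^'a" and X' x t
    using bounded_linear.has_vector_derivative[OF bounded_bilinear.bounded_linear_left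
        [OF bounded_bilinear_matrix_vector_mult] that] .
  have 1: "((\<lambda>t. co B t *v v + si B t *v w + coseries 2 B t *v d) has_vector_derivative
      (B ** si B t) *v v + co B t *v w + si B t *v d) (at t)" for t
    by (intro has_vector_derivative_add const co_has_vector_derivative si_has_vector_derivative
        coseries_2_has_vector_derivative)
  have 2: "((\<lambda>t. (B ** si B t) *v v + co B t *v w + si B t *v d) has_vector_derivative
      (B ** co B t) *v v + (B ** si B t) *v w + co B t *v d) (at t)" for t
    by (intro has_vector_derivative_add const co_has_vector_derivative si_has_vector_derivative
        bounded_linear.has_vector_derivative[OF bounded_bilinear.bounded_linear_right
          [OF bounded_bilinear_matrix_matrix_mult]])
  have 3: "(B ** co B t) *v v + (B ** si B t) *v w + co B t *v d
      = B *v (co B t *v v + si B t *v w + coseries 2 B t *v d) + d" for t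
    by (simp add: co_eq_coseries_2[of B t] matrix_vector_mul_assoc matrix_vector_right_distrib
        matrix_vector_mult_add_rdistrib matrix_add_ldistrib)
  show ?thesis
    unfolding is_solution_ivp_altdef
    using 1 2 coseries_at_0[of 1 B] coseries_at_0[of 0 B]
    by (intro exI[of _ "\<lambda>t. (B ** si B t) *v v + co B t *v w + si B t *v d"])
      (auto simp: 3 co_0 si_0 numeral_2_eq_2)
qed

text \<open>
  Propagate the state at time \<open>t\<close> up to a fixed time \<open>T\<close> by the solution formula.  The result does not depend on \<open>t\<close>; its derivative vanishes because \<open>B\<close>
  commutes with \<open>si\<close>.
\<close>

lemma ivp_unique:
  assumes "is_solution_ivp B d v w c"
  shows "c T = co B T *v v + si B T *v w + coseries 2 B T *v d"
proof -
  obtain c' where c': "\<And>t. (c has_vector_derivative c' t) (at t)"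
    "\<And>t. (c' has_vector_derivative B *v c t + d) (at t)" and init: "c 0 = v" "c' 0 = w"
    using assms unfolding is_solution_ivp_altdef by blast
  define f where "f = (\<lambda>t. co B (T - t) *v c t + si B (T - t) *v c' t + coseries 2 B (T - t) *v d)"
  have reflect: "((\<lambda>t. X (T - t)) has_vector_derivative - X') (at t)"
    if "(X has_vector_derivative X') (at (T - t))" for X :: "real \<Rightarrow> real^'a^'a" and X' t
  proof -
    have "((-) T has_vector_derivative -1) (at t)"
      by (auto intro!: derivative_eq_intros)
    from vector_diff_chain_at[OF this that] show ?thesis by (simp add: o_def)
  qed
  have "(f has_vector_derivative 0) (at t)" for t
  proof -
    have "(f has_vector_derivative
        (co B (T - t) *v c' t + (- (B ** si B (T - t))) *v c t)
        + (si B (T - t) *v (B *v c t + d) + (- co B (T - t)) *v c' t)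
        + (coseries 2 B (T - t) *v 0 + (- si B (T - t)) *v d)) (at t)"
      unfolding f_def
      by (intro has_vector_derivative_add has_vector_derivative_matrix_vector_mult c' reflect
          has_vector_derivative_const
          co_has_vector_derivative si_has_vector_derivative coseries_2_has_vector_derivative)
    moreover have "si B (T - t) *v (B *v c t) = (B ** si B (T - t)) *v c t"
      by (simp add: si_eq_coseries matrix_vector_mul_assoc coseries_matrix_commute)
    ultimately show ?thesis
      by (simp add: matrix_vector_right_distrib
          bounded_bilinear.minus_left[OF bounded_bilinear_matrix_vector_mult])
  qed
  then obtain k where "\<And>t. f t = k"
    using has_vector_derivative_zero_constant[of UNIV f] by auto
  then have "f T = f 0" by simp
  then show ?thesis
    using coseries_at_0[of 1 B] by (simp add: f_def init co_0 si_0 numeral_2_eq_2)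
qed

lemma is_solution_ivp_iff:
  "is_solution_ivp B d v w c \<longleftrightarrow> c = (\<lambda>t. co B t *v v + si B t *v w + coseries 2 B t *v d)"
  by (rule iffI, rule ext, erule ivp_unique) (simp add: ivp_solution)

text \<open>
  The two derivatives of \<open>s \<mapsto> c (t - s)\<close> differ from those of \<open>c\<close> by two sign changes, so
  reflection in time preserves the equation.  Hence the symmetric sum \<open>u s = c (t - s) + c (t + s)\<close>
  is itself a solution, for the constant term \<open>2 d\<close>; its initial velocity is \<open>0\<close>, and this removes
  \<open>si\<close> from the formula for \<open>u\<close>.
\<close>

lemma avg_curve_solution:
  assumes "is_solution B d c"
  shows "avg_curve c s t = avg_mat B s *v c t + (1/2) *\<^sub>R (coseries 2 B s *v d)"
proof -
  obtain c' where c': "\<And>t. (c has_vector_derivative c' t) (at t)"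
    "\<And>t. (c' has_vector_derivative B *v c t + d) (at t)"
    using assms unfolding is_solution_altdef by blast
  have shift: "((\<lambda>s. g (t + s)) has_vector_derivative g' (t + s)) (at s)"
    and reflect: "((\<lambda>s. g (t - s)) has_vector_derivative - g' (t - s)) (at s)"
    if "\<And>x. (g has_vector_derivative g' x) (at x)" for g g' :: "real \<Rightarrow> real^'a" and s
  proof -
    have "((+) t has_vector_derivative 1) (at s)" "((-) t has_vector_derivative -1) (at s)"
      by (auto intro!: derivative_eq_intros)
    from this[THEN vector_diff_chain_at, OF that]
    show "((\<lambda>s. g (t + s)) has_vector_derivative g' (t + s)) (at s)"
      "((\<lambda>s. g (t - s)) has_vector_derivative - g' (t - s)) (at s)"
      by (simp_all add: o_def)
  qed
  let ?u = "\<lambda>s. c (t - s) + c (t + s)"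
  let ?u' = "\<lambda>s. - c' (t - s) + c' (t + s)"
  have "(?u has_vector_derivative ?u' s) (at s)" for s
    by (intro has_vector_derivative_add shift reflect c')
  moreover have "(?u' has_vector_derivative B *v ?u s + 2 *\<^sub>R d) (at s)" for s
  proof -
    have "(?u' has_vector_derivative
        - (- (B *v c (t - s) + d)) + (B *v c (t + s) + d)) (at s)"
      by (intro has_vector_derivative_add has_vector_derivative_minus
          reflect[where g' = "\<lambda>x. B *v c x + d"] shift[where g' = "\<lambda>x. B *v c x + d"] c')
    then show ?thesis
      by (simp add: matrix_vector_right_distrib scaleR_2 algebra_simps)
  qed
  ultimately have "is_solution_ivp B (2 *\<^sub>R d) (2 *\<^sub>R c t) 0 ?u"
    unfolding is_solution_ivp_altdef by (intro exI[of _ ?u']) (auto simp: scaleR_2)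
  then have u: "?u s = co B s *v (2 *\<^sub>R c t) + coseries 2 B s *v (2 *\<^sub>R d)"
    using ivp_unique by fastforce
  have "avg_curve c s t = (1/4) *\<^sub>R (?u s + 2 *\<^sub>R c t)"
    by (simp add: avg_curve_def algebra_simps)
  also have "\<dots> = (1/2) *\<^sub>R (co B s *v c t + coseries 2 B s *v d + c t)"
    by (simp add: u matrix_vector_mult_scaleR scaleR_add_right)
  also have "\<dots> = avg_mat B s *v c t + (1/2) *\<^sub>R (coseries 2 B s *v d)"
    by (simp add: avg_mat_def scaleR_matrix_vector_assoc[symmetric]
        matrix_vector_mult_add_rdistrib scaleR_add_right)
  finally show ?thesis .
qed

section \<open>The inhomogeneities\<close>

text \<open>
  If \<open>d = B x + y\<close>, then \<open>-x\<close> is an equilibrium for the part \<open>B x\<close> of the inhomogeneity.  The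
  motion relative to it starts at \<open>v + x\<close>, and only \<open>y\<close> has to be propagated.
\<close>

lemma solution_formula_shift:
  assumes "d = B *v x + y"
  shows "co B t *v v + si B t *v w + coseries 2 B t *v d
    = co B t *v (v + x) + si B t *v w - x + coseries 2 B t *v y"
  unfolding assms
  by (simp add: matrix_vector_right_distrib coseries_2_mult_vector matrix_vector_mult_diff_rdistrib)

lemma sum_scaleR_std_basis:
  fixes x :: "real^'n" and ix :: "nat \<Rightarrow> 'n"
  assumes "bij_betw ix {1..CARD('n)} UNIV"
  shows "(\<Sum>j = 1..CARD('n). (x $ ix j) *\<^sub>R std_basis ix j) = x"
proof -
  have "(\<Sum>j = 1..CARD('n). (x $ ix j) *\<^sub>R std_basis ix j) = (\<Sum>i\<in>UNIV. (x $ i) *\<^sub>R axis i 1)"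
    unfolding std_basis_def by (rule sum.reindex_bij_betw[OF assms])
  then show ?thesis
    using basis_expansion[of x] by (simp add: scalar_mult_eq_scaleR)
qed

text \<open>
  The image of the block is spanned by all basis vectors except the last one, so the last
  coordinate of \<open>d\<close> is the only obstruction to solving \<open>d = B x\<close>.
\<close>

lemma nilpotent_jordan_block_decomposition:
  fixes B :: "real^'n^'n" and ix :: "nat \<Rightarrow> 'n"
  assumes ix: "bij_betw ix {1..CARD('n)} UNIV" and B: "is_nilpotent_jordan_block ix B"
  shows "d = B *v shift_vec ix d + (d $ ix CARD('n)) *\<^sub>R std_basis ix CARD('n)"
proof -
  obtain m where m: "CARD('n) = Suc m"
    using zero_less_card_finite[where 'a = 'n] by (cases "CARD('n)") auto
  have "B *v shift_vec ix d
      = (\<Sum>j = 1..Suc m. (if j = 1 then 0 else d $ ix (j - 1)) *\<^sub>R (B *v std_basis ix j))"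
    by (simp add: shift_vec_def tuple_def m linear_sum[OF matrix_vector_mul_linear]
        matrix_vector_mult_scaleR del: sum.cl_ivl_Suc)
  also have "\<dots> = (\<Sum>j = Suc 1..Suc m. (if j = 1 then 0 else d $ ix (j - 1)) *\<^sub>R (B *v std_basis ix j))"
    by (subst sum.atLeast_Suc_atMost) auto
  also have "\<dots> = (\<Sum>j = Suc 1..Suc m. (d $ ix (j - 1)) *\<^sub>R std_basis ix (j - 1))"
    using B by (intro sum.cong) (auto simp: is_nilpotent_jordan_block_def m)
  also have "\<dots> = (\<Sum>j = 1..m. (d $ ix j) *\<^sub>R std_basis ix j)"
    by (subst sum.shift_bounds_cl_Suc_ivl) simp
  finally show ?thesis
    using sum_scaleR_std_basis[OF ix, of d] by (simp add: m)
qed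

lemma nilpotent_jordan_block_power:
  fixes B :: "real^'n^'n"
  assumes "is_nilpotent_jordan_block ix B"
  shows "mat_power B k *v std_basis ix CARD('n)
    = (if k < CARD('n) then std_basis ix (CARD('n) - k) else 0)"
proof (induction k)
  case (Suc k)
  have "mat_power B (Suc k) *v std_basis ix CARD('n)
      = B *v (if k < CARD('n) then std_basis ix (CARD('n) - k) else 0)"
    by (simp add: matrix_vector_mul_assoc[symmetric] Suc)
  also have "\<dots> = (if Suc k < CARD('n) then std_basis ix (CARD('n) - Suc k) else 0)"
  proof (cases "CARD('n) - k = 1")
    case True
    then have "k < CARD('n)" "\<not> Suc k < CARD('n)" by linarith+
    with True assms show ?thesis by (simp add: is_nilpotent_jordan_block_def)
  next
    case False
    show ?thesis
    proof (cases "k < CARD('n)")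
      case True
      with False have "Suc k < CARD('n)" "CARD('n) - k \<in> {2..CARD('n)}" by auto
      with True assms show ?thesis by (simp add: is_nilpotent_jordan_block_def)
    qed simp
  qed
  finally show ?case .
qed simp

text \<open>
  The orbit of the last basis vector under the block runs through the basis backwards and then
  stops, so the series is a finite sum whose \<open>k\<close>-th term is the coordinate with index \<open>n - k\<close>.
\<close>

lemma coseries_2_std_basis:
  fixes B :: "real^'n^'n" and ix :: "nat \<Rightarrow> 'n"
  assumes "is_nilpotent_jordan_block ix B"
  shows "coseries 2 B t *v std_basis ix CARD('n) = c_star ix t"
proof -
  let ?n = "CARD('n)"
  have "(\<lambda>k. (t ^ (2 * k + 2) / fact (2 * k + 2)) *\<^sub>R (mat_power B k *v std_basis ix ?n)) sums
      (\<Sum>k<?n. (t ^ (2 * k + 2) / fact (2 * k + 2)) *\<^sub>R (mat_power B k *v std_basis ix ?n))"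
    by (rule sums_finite) (auto simp: nilpotent_jordan_block_power[OF assms])
  then have "coseries 2 B t *v std_basis ix ?n
      = (\<Sum>k<?n. (t ^ (2 * k + 2) / fact (2 * k + 2)) *\<^sub>R (mat_power B k *v std_basis ix ?n))"
    using coseries_vector_sums sums_unique2 by blast
  also have "\<dots> = (\<Sum>k<?n. (t ^ (2 * k + 2) / fact (2 * k + 2)) *\<^sub>R std_basis ix (?n - k))"
    by (intro sum.cong) (auto simp: nilpotent_jordan_block_power[OF assms])
  also have "\<dots> = (\<Sum>j = 1..?n. (t ^ (2 * (?n + 1 - j)) / fact (2 * (?n + 1 - j))) *\<^sub>R std_basis ix j)"
  proof (rule sum.reindex_bij_witness[of _ "\<lambda>j. ?n - j" "\<lambda>k. ?n - k"], goal_cases)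
    case (5 k)
    then have "2 * (?n + 1 - (?n - k)) = 2 * k + 2" by auto
    then show ?case by simp
  qed auto
  finally show ?thesis by (simp add: c_star_def tuple_def)
qed

lemma coseries_zero_matrix: "coseries m 0 t = (t ^ m / fact m) *\<^sub>R mat 1"
proof -
  have pow: "mat_power (0 :: real^'n^'n) k = 0" if "k \<noteq> 0" for k
    using that by (cases k) auto
  have "(\<lambda>k. (t ^ (2 * k + m) / fact (2 * k + m)) *\<^sub>R mat_power (0 :: real^'n^'n) k) sums
      (\<Sum>k\<in>{0}. (t ^ (2 * k + m) / fact (2 * k + m)) *\<^sub>R mat_power (0 :: real^'n^'n) k)"
    by (rule sums_finite) (auto simp: pow)
  then show ?thesis
    using coseries_sums[of t m "0 :: real^'n^'n"] sums_unique2 by fastforce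
qed

section \<open>Solutions and averages in the three cases\<close>

theorem proposition3:
  fixes B :: "real^'n^'n" and d :: "real^'n" and ix :: "nat \<Rightarrow> 'n"
  assumes ix: "bij_betw ix {1..CARD('n)} UNIV"
  shows "\<exists>b :: real \<Rightarrow> real^'n.
    (\<forall>c. is_solution B d c \<longrightarrow>
       (\<forall>s t. avg_curve c s t = avg_mat B s *v c t + b s)) \<and>
    (\<forall>dstar. d = B *v dstar \<longrightarrow>
       (\<forall>v w c. is_solution_ivp B d v w c \<longleftrightarrow>
          c = (\<lambda>t. co B t *v (v + dstar) + si B t *v w - dstar)) \<and>
       (\<forall>s. b s = (1/2) *\<^sub>R ((co B s - mat 1) *v dstar))) \<and>
    (is_nilpotent_jordan_block ix B \<longrightarrow>
       (\<forall>c. is_solution_ivp B (std_basis ix CARD('n)) 0 0 c \<longleftrightarrow> c = c_star ix) \<and>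
       d = B *v shift_vec ix d + (d $ ix CARD('n)) *\<^sub>R std_basis ix CARD('n) \<and>
       (\<forall>v w c. is_solution_ivp B d v w c \<longleftrightarrow>
          c = (\<lambda>t. co B t *v (v + shift_vec ix d) + si B t *v w - shift_vec ix d
                     + (d $ ix CARD('n)) *\<^sub>R c_star ix t)) \<and>
       (\<forall>s. b s = (1/2) *\<^sub>R ((co B s - mat 1) *v shift_vec ix d)
                    + ((1/2) * d $ ix CARD('n)) *\<^sub>R c_star ix s)) \<and>
    (B = 0 \<longrightarrow>
       (\<forall>v w c. is_solution_ivp B d v w c \<longleftrightarrow>
          c = (\<lambda>t. (t^2 / 2) *\<^sub>R d + t *\<^sub>R w + v)) \<and>
       (\<forall>c. is_solution B d c \<longrightarrow>
          (\<forall>s t. avg_curve c s t = c t + ((1/4) * s^2) *\<^sub>R d)) \<and>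
       (\<forall>s. b s = ((1/4) * s^2) *\<^sub>R d))"
proof -
  define b where "b = (\<lambda>s. (1/2) *\<^sub>R (coseries 2 B s *v d))"
  have avg: "avg_curve c s t = avg_mat B s *v c t + b s" if "is_solution B d c" for c s t
    using avg_curve_solution[OF that] by (simp add: b_def)
  have a: "(\<forall>v w c. is_solution_ivp B d v w c \<longleftrightarrow>
        c = (\<lambda>t. co B t *v (v + dstar) + si B t *v w - dstar)) \<and>
      (\<forall>s. b s = (1/2) *\<^sub>R ((co B s - mat 1) *v dstar))" if "d = B *v dstar" for dstar
  proof -
    have "co B t *v v + si B t *v w + coseries 2 B t *v d
        = co B t *v (v + dstar) + si B t *v w - dstar" for t v w
      using solution_formula_shift[of d B dstar 0] that by simp
    moreover have "coseries 2 B s *v d = (co B s - mat 1) *v dstar" for s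
      by (simp add: that coseries_2_mult_vector)
    ultimately show ?thesis
      by (simp only: is_solution_ivp_iff b_def simp_thms)
  qed
  have b: "(\<forall>c. is_solution_ivp B (std_basis ix CARD('n)) 0 0 c \<longleftrightarrow> c = c_star ix) \<and>
      d = B *v shift_vec ix d + (d $ ix CARD('n)) *\<^sub>R std_basis ix CARD('n) \<and>
      (\<forall>v w c. is_solution_ivp B d v w c \<longleftrightarrow>
        c = (\<lambda>t. co B t *v (v + shift_vec ix d) + si B t *v w - shift_vec ix d
                   + (d $ ix CARD('n)) *\<^sub>R c_star ix t)) \<and>
      (\<forall>s. b s = (1/2) *\<^sub>R ((co B s - mat 1) *v shift_vec ix d)
                  + ((1/2) * d $ ix CARD('n)) *\<^sub>R c_star ix s)"
    if B: "is_nilpotent_jordan_block ix B"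
  proof -
    note d = nilpotent_jordan_block_decomposition[OF ix B, of d]
    have star: "coseries 2 B t *v std_basis ix CARD('n) = c_star ix t" for t
      by (rule coseries_2_std_basis[OF B])
    have "is_solution_ivp B (std_basis ix CARD('n)) 0 0 c \<longleftrightarrow> c = c_star ix" for c
      by (simp add: is_solution_ivp_iff star)
    moreover have "is_solution_ivp B d v w c \<longleftrightarrow>
        c = (\<lambda>t. co B t *v (v + shift_vec ix d) + si B t *v w - shift_vec ix d
                   + (d $ ix CARD('n)) *\<^sub>R c_star ix t)" for v w c
      by (simp add: is_solution_ivp_iff solution_formula_shift[OF d] matrix_vector_mult_scaleR star)
    moreover have "b s = (1/2) *\<^sub>R ((co B s - mat 1) *v shift_vec ix d)
                  + ((1/2) * d $ ix CARD('n)) *\<^sub>R c_star ix s" for s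
    proof -
      have "coseries 2 B s *v d
          = coseries 2 B s *v (B *v shift_vec ix d + (d $ ix CARD('n)) *\<^sub>R std_basis ix CARD('n))"
        by (rule arg_cong[OF d])
      also have "\<dots> = (co B s - mat 1) *v shift_vec ix d + (d $ ix CARD('n)) *\<^sub>R c_star ix s"
        by (simp add: matrix_vector_right_distrib coseries_2_mult_vector
            matrix_vector_mult_scaleR star)
      finally show ?thesis
        by (simp add: b_def scaleR_add_right)
    qed
    ultimately show ?thesis by (intro conjI allI d)
  qed
  have c: "(\<forall>v w c. is_solution_ivp B d v w c \<longleftrightarrow>
        c = (\<lambda>t. (t^2 / 2) *\<^sub>R d + t *\<^sub>R w + v)) \<and>
      (\<forall>c. is_solution B d c \<longrightarrow>
        (\<forall>s t. avg_curve c s t = c t + ((1/4) * s^2) *\<^sub>R d)) \<and>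
      (\<forall>s. b s = ((1/4) * s^2) *\<^sub>R d)" if "B = 0"
  proof -
    have series: "co B t = mat 1" "si B t = t *\<^sub>R mat 1" "coseries 2 B t = (t^2 / 2) *\<^sub>R mat 1" for t
      by (simp_all add: \<open>B = 0\<close> co_eq_coseries si_eq_coseries coseries_zero_matrix)
    have bs: "b s = ((1/4) * s^2) *\<^sub>R d" for s
      by (simp add: b_def series scaleR_matrix_vector_assoc[symmetric])
    have "avg_mat B s = mat 1" for s
      by (simp add: avg_mat_def series scaleR_2[symmetric])
    with avg have "avg_curve c s t = c t + ((1/4) * s^2) *\<^sub>R d" if "is_solution B d c" for c s t
      using that by (simp add: bs)
    moreover have "is_solution_ivp B d v w c \<longleftrightarrow> c = (\<lambda>t. (t^2 / 2) *\<^sub>R d + t *\<^sub>R w + v)" for v w c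
      by (simp add: is_solution_ivp_iff series scaleR_matrix_vector_assoc[symmetric] add_ac)
    ultimately show ?thesis by (intro conjI allI impI bs)
  qed
  show ?thesis
    by (rule exI[of _ b], intro conjI[OF _ conjI[OF _ conjI]])
      (rule avg a b c allI impI | assumption)+
qed

end
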